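(* Let $\mathbb F$ be a non-archimedean (NA) valued field. For every Hausdorff NA uniform space $(X,\mathcal U)$ the free NA locally convex $\mathbb F$-space of $(X,\mathcal U)$ exists, and its structure can be described as follows. Let $D$ be the set of all $\overline{\mathcal U}$-uniformly continuous ultra-pseudometrics on $\overline X=X\cup\{\mathbf 0\}$, and for $d\in D$ let $\|\cdot\|_d$ be the Kantorovich ultra-seminorm for $d$ on $L_{\mathbb F}(X)$. Then the vector space $L_{\mathbb F}(X)$, endowed with the topology generated by the family $\Gamma=\{\|\cdot\|_d: d\in D\}$, together with the canonical map $i:X\to L_{\mathbb F}(X)$, $x\mapsto x$, is the free NA locally convex $\mathbb F$-space $L_{\mathbb F}(X,\mathcal U)$ of $(X,\mathcal U)$. Moreover, $i:(X,\mathcal U)\to L_{\mathbb F}(X,\mathcal U)$ is a uniform embedding.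
   Context: A non-archimedean (NA) valued field is a field with a valuation $|\cdot|:\mathbb F\to[0,\infty)$ with $|x|=0\iff x=0$, $|xy|=|x||y|$, $|x+y|\le\max\{|x|,|y|\}$ (the trivial valuation is allowed). An ultra-seminorm on an $\mathbb F$-vector space is a map $p\ge0$ with $p(0)=0$, $p(x+y)\le\max\{p(x),p(y)\}$, $p(\alpha x)=|\alpha|p(x)$. A uniform space is NA if its uniformity has a base consisting of equivalence relations (equivalently, it is generated by ultra-pseudometrics, i.e. pseudometrics with $d(x,z)\le\max\{d(x,y),d(y,z)\}$). An NA locally convex $\mathbb F$-space is a Hausdorff topological $\mathbb F$-vector space whose topology is generated by a family of ultra-seminorms; it carries its natural additive uniformity. $L_{\mathbb F}(X)$ is the free $\mathbb F$-vector space on the nonempty set $X$; $\mathbf 0\notin X$ is its zero vector, $\overline X:=X\cup\{\mathbf 0\}\subseteq L_{\mathbb F}(X)$. $\overline{\mathcal U}$ is the uniformity on $\overline X$ obtained from $\mathcal U$ by adding $\mathbf 0$ as an isolated point. The Kantorovich ultra-seminorm $\|\cdot\|_d$ for an ultra-pseudometric $d$ on $\overline X$ is the (pointwise) maximal ultra-seminorm $p$ on $L_{\mathbb F}(X)$ with $p(x-y)=d(x,y)$ for all $x,y\in\overline X$; it exists and is given by $\|u\|_d=\inf\{\max_{1\le i\le k}|s_i|d(a_i,b_i): u=\sum_{i=1}^k s_i(a_i-b_i),\ a_i,b_i\in\overline X,\ s_i\in\mathbb F\}$. Definition: a free NA locally convex $\mathbb F$-space of a Hausdorff NA uniform space $(X,\mathcal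 U)$ is a pair $(L,i)$ where $L$ is an NA locally convex $\mathbb F$-space and $i:X\to L$ is uniformly continuous, such that for every uniformly continuous map $\varphi:(X,\mathcal U)\to V$ into an NA locally convex $\mathbb F$-space $V$ there is a unique continuous linear map $\Phi:L\to V$ with $\Phi\circ i=\varphi$. *)

theory Defs
  imports "HOL-Analysis.Analysis" "HOL-Library.Poly_Mapping"
begin

section \<open>Non-archimedean valued fields and ultra-seminorms\<close>

definition NA_valuation :: "('f::field \<Rightarrow> real) \<Rightarrow> bool" where
  "NA_valuation val \<longleftrightarrow>
     (\<forall>x. 0 \<le> val x) \<and>
     (\<forall>x. val x = 0 \<longleftrightarrow> x = 0) \<and>
     (\<forall>x y. val (x * y) = val x * val y) \<and>
     (\<forall>x y. val (x + y) \<le> max (val x) (val y))"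

definition valuation_topology :: "('f::field \<Rightarrow> real) \<Rightarrow> 'f topology" where
  "valuation_topology val = Metric_space.mtopology UNIV (\<lambda>x y. val (x - y))"

definition ultra_seminorm ::
    "('f::field \<Rightarrow> real) \<Rightarrow> ('f \<Rightarrow> 'v::ab_group_add \<Rightarrow> 'v) \<Rightarrow> ('v \<Rightarrow> real) \<Rightarrow> bool" where
  "ultra_seminorm val smul p \<longleftrightarrow>
     (\<forall>x. 0 \<le> p x) \<and>
     p 0 = 0 \<and>
     (\<forall>x y. p (x + y) \<le> max (p x) (p y)) \<and>
     (\<forall>a x. p (smul a x) = val a * p x)"

text \<open>The set \<open>UNIV\<close> is put into the subbase so that the empty family generates the
  indiscrete topology, and not a topology with empty underlying set.\<close>

definition seminorm_topology :: "('v::ab_group_add \<Rightarrow> real) set \<Rightarrow> 'v topology" where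
  "seminorm_topology P =
     topology_generated_by (insert UNIV {{y. p (y - x) < e} | p x e. p \<in> P \<and> 0 < e})"


section \<open>Uniform spaces\<close>

text \<open>A uniformity is given, as in the class \<^class>\<open>uniform_space\<close>, by its filter of entourages;
  the axioms are those of that class, for the topology induced by the filter.\<close>

definition uniform_open :: "('a \<times> 'a) filter \<Rightarrow> 'a set \<Rightarrow> bool" where
  "uniform_open U S \<longleftrightarrow> (\<forall>x\<in>S. eventually (\<lambda>(x', y). x' = x \<longrightarrow> y \<in> S) U)"

definition is_uniformity :: "('a \<times> 'a) filter \<Rightarrow> bool" where
  "is_uniformity U \<longleftrightarrow> class.uniform_space (uniform_open U) U"

definition Hausdorff_uniformity :: "('a \<times> 'a) filter \<Rightarrow> bool" where
  "Hausdorff_uniformity U \<longleftrightarrow> class.t2_space (uniform_open U)"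

definition NA_uniformity :: "('a \<times> 'a) filter \<Rightarrow> bool" where
  "NA_uniformity U \<longleftrightarrow>
     is_uniformity U \<and>
     (\<forall>E. eventually E U \<longrightarrow>
        (\<exists>R. equiv UNIV R \<and> eventually (\<lambda>z. z \<in> R) U \<and> (\<forall>z\<in>R. E z)))"

text \<open>Uniformities on a subset \<open>S\<close> of a type are represented, like \<^term>\<open>uniformity_on S\<close>,
  by filters that contain \<open>S \<times> S\<close>.\<close>

definition uniformly_continuous_map ::
    "('a \<times> 'a) filter \<Rightarrow> ('b \<times> 'b) filter \<Rightarrow> ('a \<Rightarrow> 'b) \<Rightarrow> bool" where
  "uniformly_continuous_map U V f \<longleftrightarrow> filterlim (\<lambda>(x, y). (f x, f y)) V U"

definition prod_uniformity ::
    "('a \<times> 'a) filter \<Rightarrow> ('b \<times> 'b) filter \<Rightarrow> (('a \<times> 'b) \<times> ('a \<times> 'b)) filter" where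
  "prod_uniformity U V = filtermap (\<lambda>((x1, x2), (y1, y2)). ((x1, y1), (x2, y2))) (U \<times>\<^sub>F V)"

definition uniform_embedding ::
    "('a \<times> 'a) filter \<Rightarrow> ('b \<times> 'b) filter \<Rightarrow> ('a \<Rightarrow> 'b) \<Rightarrow> bool" where
  "uniform_embedding U V f \<longleftrightarrow>
     inj f \<and>
     uniformly_continuous_map U V f \<and>
     uniformly_continuous_map (inf V (principal (range f \<times> range f))) U (inv f)"


section \<open>Non-archimedean locally convex spaces\<close>

definition topological_vector_space ::
    "('f::field \<Rightarrow> real) \<Rightarrow> ('f \<Rightarrow> 'v::ab_group_add \<Rightarrow> 'v) \<Rightarrow> 'v topology \<Rightarrow> bool" where
  "topological_vector_space val smul T \<longleftrightarrow>
     vector_space smul \<and>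
     topspace T = UNIV \<and>
     continuous_map (prod_topology T T) T (\<lambda>(x, y). x + y) \<and>
     continuous_map (prod_topology (valuation_topology val) T) T (\<lambda>(a, x). smul a x)"

definition NA_locally_convex_space ::
    "('f::field \<Rightarrow> real) \<Rightarrow> ('f \<Rightarrow> 'v::ab_group_add \<Rightarrow> 'v) \<Rightarrow> 'v topology \<Rightarrow> bool" where
  "NA_locally_convex_space val smul T \<longleftrightarrow>
     topological_vector_space val smul T \<and>
     Hausdorff_space T \<and>
     (\<exists>P. (\<forall>p\<in>P. ultra_seminorm val smul p) \<and> T = seminorm_topology P)"

definition additive_uniformity :: "'v::ab_group_add topology \<Rightarrow> ('v \<times> 'v) filter" where
  "additive_uniformity T = filtercomap (\<lambda>(x, y). y - x) (nhdsin T 0)"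

text \<open>A definition cannot quantify over types, so the carrier type \<open>'v\<close> of the target spaces is a
  type argument; the full universal property is the statement for an arbitrary type \<open>'v\<close>.\<close>

definition free_NA_locally_convex_space ::
    "'v::ab_group_add itself \<Rightarrow> ('f::field \<Rightarrow> real) \<Rightarrow> ('x \<times> 'x) filter \<Rightarrow>
     ('f \<Rightarrow> 'l::ab_group_add \<Rightarrow> 'l) \<Rightarrow> 'l topology \<Rightarrow> ('x \<Rightarrow> 'l) \<Rightarrow> bool" where
  "free_NA_locally_convex_space _ val U smulL L i \<longleftrightarrow>
     NA_locally_convex_space val smulL L \<and>
     uniformly_continuous_map U (additive_uniformity L) i \<and>
     (\<forall>(smulV :: 'f \<Rightarrow> 'v \<Rightarrow> 'v) V \<phi>.
        NA_locally_convex_space val smulV V \<and>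
        uniformly_continuous_map U (additive_uniformity V) \<phi> \<longrightarrow>
        (\<exists>!\<Phi>. Vector_Spaces.linear smulL smulV \<Phi> \<and> continuous_map L V \<Phi> \<and> \<Phi> \<circ> i = \<phi>))"


section \<open>The free vector space and Kantorovich ultra-seminorms\<close>

text \<open>The free vector space on the type \<open>'x\<close> consists of the finitely supported functions
  \<open>'x \<Rightarrow>\<^sub>0 'f\<close>; its basis vectors are the functions \<open>single x 1\<close>.\<close>

definition free_scale :: "'f::field \<Rightarrow> ('x \<Rightarrow>\<^sub>0 'f) \<Rightarrow> ('x \<Rightarrow>\<^sub>0 'f)" where
  "free_scale a u = Poly_Mapping.map ((*) a) u"

definition free_inclusion :: "'x \<Rightarrow> ('x \<Rightarrow>\<^sub>0 'f::field)" where
  "free_inclusion x = Poly_Mapping.single x 1"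

definition pointed_set :: "('x \<Rightarrow>\<^sub>0 'f::field) set" where
  "pointed_set = insert 0 (range free_inclusion)"

text \<open>The uniformity \<open>U\<close> is transported to the basis vectors and \<open>0\<close> is added as an
  isolated point.\<close>

definition pointed_uniformity ::
    "('x \<times> 'x) filter \<Rightarrow> (('x \<Rightarrow>\<^sub>0 'f::field) \<times> ('x \<Rightarrow>\<^sub>0 'f)) filter" where
  "pointed_uniformity U =
     sup (filtermap (map_prod free_inclusion free_inclusion) U) (principal {(0, 0)})"

definition ultra_pseudometric_on :: "'a set \<Rightarrow> ('a \<Rightarrow> 'a \<Rightarrow> real) \<Rightarrow> bool" where
  "ultra_pseudometric_on S d \<longleftrightarrow>
     (\<forall>x\<in>S. \<forall>y\<in>S. 0 \<le> d x y) \<and>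
     (\<forall>x\<in>S. d x x = 0) \<and>
     (\<forall>x\<in>S. \<forall>y\<in>S. d x y = d y x) \<and>
     (\<forall>x\<in>S. \<forall>y\<in>S. \<forall>z\<in>S. d x z \<le> max (d x y) (d y z))"

text \<open>Only the restriction of \<open>d\<close> to \<^term>\<open>pointed_set\<close> matters, here and in the
  Kantorovich ultra-seminorm below.\<close>

definition uc_ultra_pseudometrics ::
    "('x \<times> 'x) filter \<Rightarrow> (('x \<Rightarrow>\<^sub>0 'f::field) \<Rightarrow> ('x \<Rightarrow>\<^sub>0 'f) \<Rightarrow> real) set" where
  "uc_ultra_pseudometrics U =
     {d. ultra_pseudometric_on pointed_set d \<and>
         uniformly_continuous_map
           (prod_uniformity (pointed_uniformity U) (pointed_uniformity U)) uniformity
           (\<lambda>(x, y). d x y)}"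

definition is_kantorovich ::
    "('f::field \<Rightarrow> real) \<Rightarrow> (('x \<Rightarrow>\<^sub>0 'f) \<Rightarrow> ('x \<Rightarrow>\<^sub>0 'f) \<Rightarrow> real) \<Rightarrow>
     (('x \<Rightarrow>\<^sub>0 'f) \<Rightarrow> real) \<Rightarrow> bool" where
  "is_kantorovich val d p \<longleftrightarrow>
     (ultra_seminorm val free_scale p \<and> (\<forall>x\<in>pointed_set. \<forall>y\<in>pointed_set. p (x - y) = d x y)) \<and>
     (\<forall>q. ultra_seminorm val free_scale q \<and>
          (\<forall>x\<in>pointed_set. \<forall>y\<in>pointed_set. q (x - y) = d x y) \<longrightarrow> (\<forall>u. q u \<le> p u))"

text \<open>A maximal such seminorm is unique; it exists whenever \<open>val\<close> is a non-archimedean valuation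
  and \<open>d\<close> an ultra-pseudometric on \<^term>\<open>pointed_set\<close>.\<close>

definition kantorovich ::
    "('f::field \<Rightarrow> real) \<Rightarrow> (('x \<Rightarrow>\<^sub>0 'f) \<Rightarrow> ('x \<Rightarrow>\<^sub>0 'f) \<Rightarrow> real) \<Rightarrow>
     ('x \<Rightarrow>\<^sub>0 'f) \<Rightarrow> real" where
  "kantorovich val d = (THE p. is_kantorovich val d p)"

definition free_topology ::
    "('f::field \<Rightarrow> real) \<Rightarrow> ('x \<times> 'x) filter \<Rightarrow> ('x \<Rightarrow>\<^sub>0 'f) topology" where
  "free_topology val U = seminorm_topology (kantorovich val ` uc_ultra_pseudometrics U)"

end

theory Submission
  imports Defs
begin

text \<open>The Kantorovich ultra-seminorm of \<open>d\<close> is the pointwise supremum of all ultra-seminorms \<open>q\<close> with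
  \<open>q (x - y) \<le> d x y\<close>; indicator functions of \<open>d\<close>-balls provide enough of them for the supremum to
  attain \<open>d\<close>. If \<open>q\<close> is any ultra-seminorm on the free vector space for which the inclusion of \<open>X\<close>
  is uniformly continuous, then \<open>d x y = q (x - y)\<close> is a uniformly continuous
  ultra-pseudometric, and \<open>q\<close> lies below its Kantorovich ultra-seminorm by maximality. Applied to
  \<open>q = p \<circ> \<Phi>\<close>, where \<open>\<Phi>\<close> is the linear extension of \<open>\<phi>\<close>, this makes \<open>\<Phi>\<close> continuous; applied to
  the sum of the coefficients over a class of an entourage that is an equivalence relation, it
  gives the Hausdorff property.\<close>

section \<open>Ultra-seminorms and the topologies they generate\<close>

lemma NA_valuation_one: "NA_valuation val \<Longrightarrow> val 1 = 1"
  unfolding NA_valuation_def by (metis mult_cancel_left1 one_neq_zero)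

lemma NA_valuation_zero: "NA_valuation val \<Longrightarrow> val 0 = 0"
  unfolding NA_valuation_def by blast

text \<open>The value of -1 is nonnegative with square 1, hence 1.\<close>

lemma NA_valuation_minus:
  assumes "NA_valuation val"
  shows "val (- x) = val x"
proof -
  have mult: "val (a * b) = val a * val b" for a b
    using assms unfolding NA_valuation_def by blast
  have "0 \<le> val (-1)"
    using assms unfolding NA_valuation_def by blast
  moreover have "(val (-1))\<^sup>2 = 1"
    using mult[of "-1" "-1"] NA_valuation_one[OF assms] by (simp add: power2_eq_square)
  ultimately have "val (-1) = 1"
    by (simp add: power2_eq_1_iff)
  then show ?thesis
    using mult[of "-1" x] by simp
qed

lemma NA_valuation_Metric_space:
  assumes "NA_valuation val"
  shows "Metric_space UNIV (\<lambda>x y. val (x - y))"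
proof
  fix x y z
  show "0 \<le> val (x - y)" "val (x - y) = 0 \<longleftrightarrow> x = y"
    using assms unfolding NA_valuation_def by auto
  show "val (x - y) = val (y - x)"
    using NA_valuation_minus[OF assms, of "x - y"] by simp
  have "val (x - z) \<le> max (val (x - y)) (val (y - z))" "0 \<le> val (x - y)" "0 \<le> val (y - z)"
    using assms unfolding NA_valuation_def by (metis diff_add_cancel add_diff_eq, blast+)
  then show "val (x - z) \<le> val (x - y) + val (y - z)"
    by linarith
qed

lemma ultra_seminorm_minus:
  assumes "NA_valuation val" "vector_space s" "ultra_seminorm val s p"
  shows "p (- x) = p x"
proof -
  interpret vector_space s by fact
  have "p (- x) = p (s (- 1) x)"
    by simp
  also have "\<dots> = p x"
    using assms(3) NA_valuation_minus[OF assms(1), of 1] NA_valuation_one[OF assms(1)]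
    unfolding ultra_seminorm_def by (metis mult_1)
  finally show ?thesis .
qed

lemma ultra_seminorm_commute:
  assumes "NA_valuation val" "vector_space s" "ultra_seminorm val s p"
  shows "p (x - y) = p (y - x)"
  using ultra_seminorm_minus[OF assms, of "x - y"] by simp

lemma ultra_seminorm_triangle:
  assumes "ultra_seminorm val s p"
  shows "p (x - z) \<le> max (p (x - y)) (p (y - z))"
  using assms unfolding ultra_seminorm_def by (metis diff_add_cancel add_diff_eq)

text \<open>The sum is a cruder bound than the maximum, but it makes sense for empty
  \<open>A\<close> too and is good enough to bound suprema.\<close>

lemma ultra_seminorm_sum:
  assumes "ultra_seminorm val s p"
  shows "p (\<Sum>x\<in>A. f x) \<le> (\<Sum>x\<in>A. p (f x))"
proof (induction A rule: infinite_finite_induct)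
  case (insert x A)
  have "p (f x + sum f A) \<le> max (p (f x)) (p (sum f A))" "0 \<le> p (f x)" "0 \<le> p (sum f A)"
    using assms unfolding ultra_seminorm_def by auto
  with insert show ?case
    by simp
qed (use assms in \<open>auto simp: ultra_seminorm_def\<close>)

lemma ultra_seminorm_compose_linear:
  assumes "ultra_seminorm val s2 p" "Vector_Spaces.linear s1 s2 f"
  shows "ultra_seminorm val s1 (\<lambda>u. p (f u))"
proof -
  interpret Vector_Spaces.linear s1 s2 f by fact
  show ?thesis
    using assms(1) unfolding ultra_seminorm_def by (simp add: add scale)
qed

text \<open>Here the field is a vector space over itself. Pulling these functions back along linear
  functionals yields the concrete ultra-seminorms used below.\<close>

lemma ultra_seminorm_valuation:
  assumes "NA_valuation val" "0 \<le> r"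
  shows "ultra_seminorm val (*) (\<lambda>a. r * val a)"
proof -
  have "r * val (x + y) \<le> max (r * val x) (r * val y)" for x y
  proof -
    have "val (x + y) \<le> max (val x) (val y)"
      using assms unfolding NA_valuation_def by blast
    then have "r * val (x + y) \<le> r * max (val x) (val y)"
      using assms(2) by (rule mult_left_mono)
    then show ?thesis
      using assms(2) by (simp add: max_mult_distrib_left)
  qed
  with assms show ?thesis
    unfolding ultra_seminorm_def NA_valuation_def by auto
qed

text \<open>Inequalities pass to pointwise suprema directly; homogeneity is an equality and takes an
  extra argument. Boundedness makes the real suprema meaningful.\<close>

lemma ultra_seminorm_SUP:
  assumes val: "NA_valuation val" and s: "vector_space s"
    and ne: "Q \<noteq> {}" and Q: "\<And>q. q \<in> Q \<Longrightarrow> ultra_seminorm val s q"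
    and bdd: "\<And>u. bdd_above ((\<lambda>q. q u) ` Q)"
  shows "ultra_seminorm val s (\<lambda>u. SUP q\<in>Q. q u)"
proof -
  interpret vector_space s by fact
  let ?p = "\<lambda>u. SUP q\<in>Q. q u"
  have le: "q u \<le> ?p u" if "q \<in> Q" for q u
    using that bdd by (rule cSUP_upper)
  have nonneg: "0 \<le> ?p u" for u
  proof -
    obtain q where "q \<in> Q" using ne by blast
    then show ?thesis
      using le[of q u] Q[of q] unfolding ultra_seminorm_def by (meson order_trans)
  qed
  have scale_le: "?p (s a u) \<le> val a * ?p u" for a u
  proof (rule cSUP_least[OF ne])
    fix q assume "q \<in> Q"
    then show "q (s a u) \<le> val a * ?p u"
      using le[of q u] Q[of q] val unfolding ultra_seminorm_def NA_valuation_def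
      by (simp add: mult_left_mono)
  qed
  have scale: "?p (s a u) = val a * ?p u" for a u
  proof (cases "a = 0")
    case True
    then show ?thesis
      using scale_le[of 0 u] nonneg[of "s 0 u"] val unfolding NA_valuation_def
      by (metis mult_zero_left order_antisym)
  next
    case False
    have inv: "val a * val (inverse a) = 1" and pos: "0 \<le> val a"
      using val False NA_valuation_one[OF val] unfolding NA_valuation_def
      by (metis right_inverse, blast)
    \<comment> \<open>The reverse inequality for \<open>a\<close> is \<open>scale_le\<close> for
      \<open>inverse a\<close>, applied to \<open>s a u\<close>.\<close>
    have "val a * ?p u = val a * ?p (s (inverse a) (s a u))"
      using False by simp
    also have "\<dots> \<le> val a * (val (inverse a) * ?p (s a u))"
      using scale_le pos by (rule mult_left_mono)
    also have "\<dots> = ?p (s a u)"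
      using inv by (simp flip: mult.assoc)
    finally show ?thesis
      using scale_le by (rule order_antisym[rotated])
  qed
  have "?p (x + y) \<le> max (?p x) (?p y)" for x y
  proof (rule cSUP_least[OF ne])
    fix q assume q: "q \<in> Q"
    then have "q (x + y) \<le> max (q x) (q y)"
      using Q unfolding ultra_seminorm_def by blast
    with le[OF q, of x] le[OF q, of y] show "q (x + y) \<le> max (?p x) (?p y)"
      by linarith
  qed
  moreover have "?p 0 = 0"
  proof -
    have "(\<lambda>q. q 0) ` Q = {0}"
      using ne Q unfolding ultra_seminorm_def by force
    then show ?thesis by simp
  qed
  ultimately show ?thesis
    using nonneg scale unfolding ultra_seminorm_def by blast
qed

section \<open>Topologies generated by families of ultra-seminorms\<close>

lemma topspace_seminorm_topology [simp]: "topspace (seminorm_topology P) = UNIV"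
  unfolding seminorm_topology_def by simp

lemma openin_seminorm_ball:
  assumes "p \<in> P" "0 < e"
  shows "openin (seminorm_topology P) {y. p (y - x) < e}"
  unfolding seminorm_topology_def using assms by (intro topology_generated_by_Basis) auto

lemma continuous_map_into_seminorm_topology:
  assumes "\<And>p x e. \<lbrakk>p \<in> P; 0 < e\<rbrakk> \<Longrightarrow> openin T {z \<in> topspace T. p (f z - x) < e}"
  shows "continuous_map T (seminorm_topology P) f"
  unfolding seminorm_topology_def
proof (rule continuous_on_generated_topo)
  fix B assume "B \<in> insert UNIV {{y. p (y - x) < e} |p x e. p \<in> P \<and> 0 < e}"
  then consider "B = UNIV" | p x e where "p \<in> P" "0 < e" "B = {y. p (y - x) < e}"
    by auto
  then show "openin T (f -` B \<inter> topspace T)"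
  proof cases
    case 2
    then have "f -` B \<inter> topspace T = {z \<in> topspace T. p (f z - x) < e}"
      by auto
    with assms 2 show ?thesis
      by simp
  qed simp
qed auto

text \<open>A subbasic ball with any centre \<open>x\<close> that contains 0 also contains the ball
  of the same radius around 0, by the ultrametric inequality. Balls centred at 0 therefore decide
  convergence to 0.\<close>

lemma filterlim_nhdsin_seminorm_topology:
  assumes P: "\<And>p. p \<in> P \<Longrightarrow> ultra_seminorm val s p"
  shows "filterlim f (nhdsin (seminorm_topology P) 0) F \<longleftrightarrow>
         (\<forall>p\<in>P. \<forall>e>0. \<forall>\<^sub>F z in F. p (f z) < e)"
proof
  assume lim: "filterlim f (nhdsin (seminorm_topology P) 0) F"
  show "\<forall>p\<in>P. \<forall>e>0. \<forall>\<^sub>F z in F. p (f z) < e"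
  proof (intro ballI allI impI)
    fix p and e :: real assume pe: "p \<in> P" "0 < e"
    have "\<forall>\<^sub>F y in nhdsin (seminorm_topology P) 0. p y < e"
      unfolding eventually_nhdsin
      using openin_seminorm_ball[OF pe, of 0] pe P[of p]
      by (intro disjI2 exI[of _ "{y. p (y - 0) < e}"]) (auto simp: ultra_seminorm_def)
    with lim show "\<forall>\<^sub>F z in F. p (f z) < e"
      unfolding filterlim_iff by blast
  qed
next
  assume R: "\<forall>p\<in>P. \<forall>e>0. \<forall>\<^sub>F z in F. p (f z) < e"
  have "\<forall>\<^sub>F z in F. f z \<in> S"
    if "generate_topology_on (insert UNIV {{y. p (y - x) < e} |p x e. p \<in> P \<and> 0 < e}) S"
      and "0 \<in> S" for S
    using that
  proof (induction rule: generate_topology_on.induct)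
    case (Int a b)
    then show ?case by (simp add: eventually_conj)
  next
    case (UN K)
    then obtain k where "k \<in> K" "0 \<in> k" by blast
    then show ?case
      using UN.IH[of k] by (auto elim: eventually_mono)
  next
    case (Basis S)
    then consider "S = UNIV" | p x e where "p \<in> P" "0 < e" "S = {y. p (y - x) < e}"
      by auto
    then show ?case
    proof cases
      case 2
      have "p (f z - x) < e" if "p (f z) < e" for z
        using ultra_seminorm_triangle[OF P[OF \<open>p \<in> P\<close>], of "f z" x 0] that Basis.prems 2
        by simp
      moreover have "\<forall>\<^sub>F z in F. p (f z) < e"
        using R 2 by blast
      ultimately show ?thesis
        using 2 by (auto elim: eventually_mono)
    qed simp
  qed simp
  then have "\<forall>\<^sub>F z in F. f z \<in> S" if "openin (seminorm_topology P) S" "0 \<in> S" for S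
    using that unfolding seminorm_topology_def openin_topology_generated_by_iff by blast
  then show "filterlim f (nhdsin (seminorm_topology P) 0) F"
    unfolding filterlim_iff eventually_nhdsin
    by simp (metis (mono_tags, lifting) eventually_mono)
qed

lemma topological_vector_space_seminorm_topology:
  assumes val: "NA_valuation val" and s: "vector_space s"
    and P: "\<And>p. p \<in> P \<Longrightarrow> ultra_seminorm val s p"
  shows "topological_vector_space val s (seminorm_topology P)"
proof -
  interpret vector_space s by fact
  interpret F: Metric_space UNIV "\<lambda>x y. val (x - y)"
    using val by (rule NA_valuation_Metric_space)
  let ?T = "seminorm_topology P"
  have "continuous_map (prod_topology ?T ?T) ?T (\<lambda>(x, y). x + y)"
  proof (rule continuous_map_into_seminorm_topology)
    fix p x and e :: real assume p: "p \<in> P" and e: "0 < e"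
    note sp = P[OF p]
    have close: "p (a' + b' - x) < e"
      if "p (a + b - x) < e" "p (a' - a) < e" "p (b' - b) < e" for a b a' b'
    proof -
      have "p (a' + b' - x) \<le> max (p (a' + b' - (a + b))) (p (a + b - x))"
        by (rule ultra_seminorm_triangle[OF sp])
      moreover have "p (a' + b' - (a + b)) \<le> max (p (a' - a)) (p (b' - b))"
        using sp unfolding ultra_seminorm_def by (metis add_diff_add)
      ultimately show ?thesis using that by linarith
    qed
    have zero: "p 0 < e"
      using sp e unfolding ultra_seminorm_def by simp
    show "openin (prod_topology ?T ?T)
        {z \<in> topspace (prod_topology ?T ?T). p ((case z of (x, y) \<Rightarrow> x + y) - x) < e}"
      unfolding openin_prod_topology_alt
    proof (intro allI impI)
      fix a b
      assume "(a, b) \<in> {z \<in> topspace (prod_topology ?T ?T). p ((case z of (x, y) \<Rightarrow> x + y) - x) < e}"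
      with close zero show "\<exists>A B. openin ?T A \<and> openin ?T B \<and> a \<in> A \<and> b \<in> B \<and>
          A \<times> B \<subseteq> {z \<in> topspace (prod_topology ?T ?T). p ((case z of (x, y) \<Rightarrow> x + y) - x) < e}"
        by (intro exI[of _ "{z. p (z - a) < e}"] exI[of _ "{z. p (z - b) < e}"])
           (auto intro!: openin_seminorm_ball p e)
    qed
  qed
  moreover have "continuous_map (prod_topology (valuation_topology val) ?T) ?T (\<lambda>(a, x). s a x)"
  proof (rule continuous_map_into_seminorm_topology)
    fix p x and e :: real assume p: "p \<in> P" and e: "0 < e"
    note sp = P[OF p]
    have nonneg: "0 \<le> p y" "0 \<le> val a" for y a
      using sp val unfolding ultra_seminorm_def NA_valuation_def by blast+
    show "openin (prod_topology (valuation_topology val) ?T)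
        {z \<in> topspace (prod_topology (valuation_topology val) ?T).
          p ((case z of (a, x) \<Rightarrow> s a x) - x) < e}"
      unfolding openin_prod_topology_alt
    proof (intro allI impI)
      fix a y
      assume "(a, y) \<in> {z \<in> topspace (prod_topology (valuation_topology val) ?T).
          p ((case z of (a, x) \<Rightarrow> s a x) - x) < e}"
      then have ay: "p (s a y - x) < e" by simp
      \<comment> \<open>The cap 1 gives \<open>val b \<le> val a + 1\<close>, so that \<epsilon> can
        be chosen from \<open>a\<close> and \<open>e\<close> alone. Adding 1 in the denominators
        keeps them positive when \<open>p y\<close> or \<open>val a\<close> is 0.\<close>
      define \<delta> where "\<delta> = min 1 (e / (p y + 1))"
      define \<epsilon> where "\<epsilon> = e / (val a + 1)"
      have \<delta>: "0 < \<delta>" "\<delta> \<le> 1" "\<delta> * (p y + 1) \<le> e"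
        using e nonneg(1)[of y] by (auto simp: \<delta>_def min_def not_le pos_less_divide_eq)
      have \<epsilon>: "0 < \<epsilon>" "\<epsilon> * (val a + 1) = e"
        using e nonneg(2)[of a] by (auto simp: \<epsilon>_def field_simps)
      have close: "p (s b z - x) < e" if "val (a - b) < \<delta>" "p (z - y) < \<epsilon>" for b z
      proof -
        have ba: "val (b - a) < \<delta>"
          using that F.commute by simp
        have "val b \<le> max (val (b - a)) (val a)"
          using val unfolding NA_valuation_def by (metis diff_add_cancel)
        then have "val b \<le> val a + 1"
          using ba \<delta> nonneg(2)[of a] by linarith
        then have "val b * p (z - y) \<le> (val a + 1) * p (z - y)"
          using nonneg by (intro mult_right_mono) auto
        also have "\<dots> < (val a + 1) * \<epsilon>"
          using that nonneg(2)[of a] by (intro mult_strict_left_mono) auto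
        finally have 1: "p (s b (z - y)) < e"
          using \<epsilon> sp unfolding ultra_seminorm_def by (simp add: mult.commute)
        have "val (b - a) * p y \<le> \<delta> * p y"
          using ba nonneg by (intro mult_right_mono) auto
        also have "\<dots> < \<delta> * (p y + 1)"
          using \<delta> by simp
        finally have 2: "p (s (b - a) y) < e"
          using \<delta> sp unfolding ultra_seminorm_def by simp
        \<comment> \<open>The path from \<open>s b z\<close> to \<open>x\<close> runs through
          \<open>s b y\<close> and \<open>s a y\<close>: first the vector changes, then the
          scalar.\<close>
        have "p (s b z - s a y) \<le> max (p (s b z - s b y)) (p (s b y - s a y))"
          "p (s b z - x) \<le> max (p (s b z - s a y)) (p (s a y - x))"
          by (rule ultra_seminorm_triangle[OF sp])+
        with 1 2 ay show ?thesis
          by (simp add: scale_right_diff_distrib scale_left_diff_distrib)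
      qed
      show "\<exists>A B. openin (valuation_topology val) A \<and> openin ?T B \<and> a \<in> A \<and> y \<in> B \<and>
          A \<times> B \<subseteq> {z \<in> topspace (prod_topology (valuation_topology val) ?T).
            p ((case z of (a, x) \<Rightarrow> s a x) - x) < e}"
      proof (intro exI conjI)
        show "openin (valuation_topology val) (F.mball a \<delta>)"
          unfolding valuation_topology_def by (rule F.openin_mball)
        show "openin ?T {z. p (z - y) < \<epsilon>}"
          using p \<epsilon> by (intro openin_seminorm_ball)
        show "a \<in> F.mball a \<delta>" "y \<in> {z. p (z - y) < \<epsilon>}"
          using \<delta>(1) \<epsilon>(1) sp F.zero[of a a] by (auto simp: ultra_seminorm_def)
        show "F.mball a \<delta> \<times> {z. p (z - y) < \<epsilon>} \<subseteq>
          {z \<in> topspace (prod_topology (valuation_topology val) ?T).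
            p ((case z of (a, x) \<Rightarrow> s a x) - x) < e}"
          using close by (auto simp: valuation_topology_def)
      qed
    qed
  qed
  ultimately show ?thesis
    using s unfolding topological_vector_space_def by simp
qed

text \<open>Balls around \<open>x\<close> and \<open>y\<close> of the full radius
  \<open>p (x - y)\<close> are already disjoint, by the strong triangle inequality.\<close>

lemma Hausdorff_seminorm_topology:
  assumes val: "NA_valuation val" and s: "vector_space s"
    and P: "\<And>p. p \<in> P \<Longrightarrow> ultra_seminorm val s p"
    and sep: "\<And>u. u \<noteq> 0 \<Longrightarrow> \<exists>p\<in>P. p u \<noteq> 0"
  shows "Hausdorff_space (seminorm_topology P)"
  unfolding Hausdorff_space_def
proof (intro allI impI)
  fix x y assume "x \<in> topspace (seminorm_topology P) \<and> y \<in> topspace (seminorm_topology P) \<and> x \<noteq> y"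
  then obtain p where p: "p \<in> P" "p (x - y) \<noteq> 0"
    using sep[of "x - y"] by auto
  note sp = P[OF p(1)]
  define e where "e = p (x - y)"
  have e: "0 < e"
    using p sp unfolding e_def ultra_seminorm_def by (metis order_le_less)
  have "False" if "p (z - x) < e" "p (z - y) < e" for z
    using ultra_seminorm_triangle[OF sp, of x y z] ultra_seminorm_commute[OF val s sp, of x z] that
    unfolding e_def by auto
  then show "\<exists>A B. openin (seminorm_topology P) A \<and> openin (seminorm_topology P) B \<and>
      x \<in> A \<and> y \<in> B \<and> disjnt A B"
    using e sp openin_seminorm_ball[OF p(1) e]
    by (intro exI[of _ "{z. p (z - x) < e}"] exI[of _ "{z. p (z - y) < e}"])
       (auto simp: disjnt_def ultra_seminorm_def)
qed

text \<open>The additive uniformity is pulled back along the difference map, so uniform continuity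
  says that \<open>f y - f x\<close> tends to 0 along \<open>U\<close>.\<close>

lemma uniformly_continuous_map_into_seminorm_topology:
  assumes "\<And>p. p \<in> P \<Longrightarrow> ultra_seminorm val s p"
  shows "uniformly_continuous_map U (additive_uniformity (seminorm_topology P)) f \<longleftrightarrow>
         (\<forall>p\<in>P. \<forall>e>0. \<forall>\<^sub>F (x, y) in U. p (f y - f x) < e)"
  unfolding uniformly_continuous_map_def additive_uniformity_def filterlim_filtercomap_iff comp_def
  by (simp add: case_prod_unfold filterlim_nhdsin_seminorm_topology[OF assms])

section \<open>Linear maps on the free vector space\<close>

lemma lookup_free_scale [simp]: "Poly_Mapping.lookup (free_scale a u) x = a * Poly_Mapping.lookup u x"
  unfolding free_scale_def by transfer (simp add: when_def)

lemma vector_space_free_scale: "vector_space free_scale"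
  by unfold_locales
    (auto intro!: poly_mapping_eqI simp: lookup_add algebra_simps)

lemma inj_free_inclusion: "inj (free_inclusion :: 'x \<Rightarrow> 'x \<Rightarrow>\<^sub>0 'f::field)"
  by (metis (mono_tags, lifting) free_inclusion_def injI lookup_single_eq lookup_single_not_eq zero_neq_one)

lemma free_inclusion_eq_iff [simp]: "(free_inclusion x :: 'x \<Rightarrow>\<^sub>0 'f::field) = free_inclusion y \<longleftrightarrow> x = y"
  using inj_free_inclusion by (rule inj_eq)

lemma free_inclusion_in_pointed_set [simp]: "free_inclusion x \<in> pointed_set"
  and zero_in_pointed_set [simp]: "0 \<in> pointed_set"
  unfolding pointed_set_def by auto

definition linear_extension ::
    "('f::field \<Rightarrow> 'v::ab_group_add \<Rightarrow> 'v) \<Rightarrow> ('x \<Rightarrow> 'v) \<Rightarrow> ('x \<Rightarrow>\<^sub>0 'f) \<Rightarrow> 'v" where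
  "linear_extension s g u = (\<Sum>x\<in>Poly_Mapping.keys u. s (Poly_Mapping.lookup u x) (g x))"

text \<open>Coefficients off the support vanish; vectors with different supports can thus be summed
  over one index set.\<close>

lemma linear_extension_superset:
  assumes "vector_space s" "finite A" "Poly_Mapping.keys u \<subseteq> A"
  shows "linear_extension s g u = (\<Sum>x\<in>A. s (Poly_Mapping.lookup u x) (g x))"
proof -
  interpret vector_space s by fact
  show ?thesis
    unfolding linear_extension_def using assms(2,3)
    by (intro sum.mono_neutral_left) (auto simp: in_keys_iff)
qed

lemma linear_linear_extension:
  fixes g :: "'x \<Rightarrow> 'v::ab_group_add" and s :: "'f::field \<Rightarrow> 'v \<Rightarrow> 'v"
  assumes "vector_space s"
  shows "Vector_Spaces.linear free_scale s (linear_extension s g)"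
proof -
  interpret vector_space s by fact
  interpret F: vector_space "free_scale :: 'f \<Rightarrow> ('x \<Rightarrow>\<^sub>0 'f) \<Rightarrow> _" by (rule vector_space_free_scale)
  note ext = linear_extension_superset[OF assms]
  show ?thesis
  proof
    fix u v :: "'x \<Rightarrow>\<^sub>0 'f"
    let ?A = "Poly_Mapping.keys u \<union> Poly_Mapping.keys v"
    have "linear_extension s g (u + v) = (\<Sum>x\<in>?A. s (Poly_Mapping.lookup (u + v) x) (g x))"
      using Poly_Mapping.keys_add[of u v] by (intro ext) auto
    also have "\<dots> = linear_extension s g u + linear_extension s g v"
      by (simp add: ext[of ?A] lookup_add scale_left_distrib sum.distrib)
    finally show "linear_extension s g (u + v) = linear_extension s g u + linear_extension s g v" .
  next
    fix a and u :: "'x \<Rightarrow>\<^sub>0 'f"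
    have "linear_extension s g (free_scale a u) =
        (\<Sum>x\<in>Poly_Mapping.keys u. s (Poly_Mapping.lookup (free_scale a u) x) (g x))"
      by (intro ext) (auto simp: in_keys_iff)
    then show "linear_extension s g (free_scale a u) = s a (linear_extension s g u)"
      by (simp add: linear_extension_def scale_sum_right)
  qed
qed

lemma linear_extension_free_inclusion [simp]:
  assumes "vector_space s"
  shows "linear_extension s g (free_inclusion x) = g x"
proof -
  interpret vector_space s by fact
  show ?thesis
    by (simp add: linear_extension_def free_inclusion_def)
qed

text \<open>Expansion in the basis: it gives both the uniqueness of linear extensions and the bound
  on ultra-seminorms by their values on the basis.\<close>

lemma sum_free_inclusion:
  "(\<Sum>x\<in>Poly_Mapping.keys u. free_scale (Poly_Mapping.lookup u x) (free_inclusion x)) = u"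
proof (rule poly_mapping_eqI)
  fix y
  have "(\<Sum>x\<in>Poly_Mapping.keys u. Poly_Mapping.lookup u x * Poly_Mapping.lookup (free_inclusion x) y)
      = (\<Sum>x\<in>Poly_Mapping.keys u. if x = y then Poly_Mapping.lookup u x else 0)"
    by (intro sum.cong) (auto simp: free_inclusion_def lookup_single when_def)
  then show "Poly_Mapping.lookup
      (\<Sum>x\<in>Poly_Mapping.keys u. free_scale (Poly_Mapping.lookup u x) (free_inclusion x)) y =
      Poly_Mapping.lookup u y"
    by (simp add: lookup_sum in_keys_iff)
qed

lemma linear_eq_linear_extension:
  assumes "Vector_Spaces.linear free_scale s f" "f \<circ> free_inclusion = g"
  shows "f = linear_extension s g"
proof
  interpret Vector_Spaces.linear free_scale s f by fact
  fix u
  have "f u = f (\<Sum>x\<in>Poly_Mapping.keys u. free_scale (Poly_Mapping.lookup u x) (free_inclusion x))"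
    by (simp only: sum_free_inclusion)
  also have "\<dots> = linear_extension s g u"
    unfolding linear_extension_def using assms(2) by (auto simp: sum scale)
  finally show "f u = linear_extension s g u" .
qed

section \<open>The Kantorovich ultra-seminorm\<close>

text \<open>Control by the basis values is what bounds all ultra-seminorms below a given
  \<open>d\<close> simultaneously.\<close>

lemma ultra_seminorm_le_sum_keys:
  assumes "ultra_seminorm val free_scale q"
  shows "q u \<le> (\<Sum>x\<in>Poly_Mapping.keys u. val (Poly_Mapping.lookup u x) * q (free_inclusion x))"
proof -
  have "q u = q (\<Sum>x\<in>Poly_Mapping.keys u. free_scale (Poly_Mapping.lookup u x) (free_inclusion x))"
    by (simp only: sum_free_inclusion)
  also have "\<dots> \<le> (\<Sum>x\<in>Poly_Mapping.keys u. q (free_scale (Poly_Mapping.lookup u x) (free_inclusion x)))"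
    by (rule ultra_seminorm_sum[OF assms])
  finally show ?thesis
    using assms unfolding ultra_seminorm_def by simp
qed

text \<open>If \<open>h\<close> is the indicator function of the ball \<open>{z. d x z < r}\<close> with \<open>r = d x y\<close>, then
  \<open>r * val\<close> composed with the linear functional \<open>f\<close> satisfying \<open>f (a - b) = h a - h b\<close> is an
  ultra-seminorm below \<open>d\<close> that agrees with \<open>d\<close> at \<open>(x, y)\<close>.\<close>

lemma ultra_seminorm_attaining_distance:
  fixes d :: "('x \<Rightarrow>\<^sub>0 'f::field) \<Rightarrow> ('x \<Rightarrow>\<^sub>0 'f) \<Rightarrow> real"
  assumes val: "NA_valuation val" and d: "ultra_pseudometric_on pointed_set d"
    and xy: "x \<in> pointed_set" "y \<in> pointed_set"
  obtains q where "ultra_seminorm val free_scale q"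
    and "\<And>a b. \<lbrakk>a \<in> pointed_set; b \<in> pointed_set\<rbrakk> \<Longrightarrow> q (a - b) \<le> d a b"
    and "q (x - y) = d x y"
proof
  define r where "r = d x y"
  define h :: "('x \<Rightarrow>\<^sub>0 'f) \<Rightarrow> 'f" where "h z = (if d x z < r then 1 else 0)" for z
  \<comment> \<open>Subtracting \<open>h 0\<close> makes \<open>f a = h a - h 0\<close> hold at
    \<open>a = 0\<close> as well, so that the constant cancels in differences.\<close>
  define f where "f = linear_extension (*) (\<lambda>z. h (free_inclusion z) - h 0)"
  have vs: "vector_space ((*) :: 'f \<Rightarrow> 'f \<Rightarrow> 'f)"
    by unfold_locales (auto simp: algebra_simps)
  then have lin: "Vector_Spaces.linear free_scale (*) f"
    unfolding f_def by (rule linear_linear_extension)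
  interpret Vector_Spaces.linear free_scale "(*)" f by fact
  have r: "0 \<le> r"
    using d xy unfolding r_def ultra_pseudometric_on_def by blast
  have "f a = h a - h 0" if "a \<in> pointed_set" for a
    using that vs unfolding pointed_set_def by (auto simp: f_def zero[unfolded f_def])
  then have f: "f (a - b) = h a - h b" if "a \<in> pointed_set" "b \<in> pointed_set" for a b
    using that by (simp add: diff)
  show "ultra_seminorm val free_scale (\<lambda>u. r * val (f u))"
    by (rule ultra_seminorm_compose_linear[OF ultra_seminorm_valuation[OF val r] lin])
  have v: "val 0 = 0" "val 1 = 1" "val (-1) = 1"
    using val NA_valuation_one[OF val] NA_valuation_minus[OF val, of 1]
    by (auto simp: NA_valuation_def)
  show "r * val (f (a - b)) \<le> d a b" if ab: "a \<in> pointed_set" "b \<in> pointed_set" for a b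
  proof -
    \<comment> \<open>The left side is nonzero only if exactly one of \<open>a\<close>,
      \<open>b\<close> lies in the ball; the ultrametric inequality then forces
      \<open>d a b \<ge> r\<close>.\<close>
    have "0 \<le> d a b" "d a b = d b a" "d x a \<le> max (d x b) (d b a)" "d x b \<le> max (d x a) (d a b)"
      using d ab xy unfolding ultra_pseudometric_on_def by blast+
    then show ?thesis
      by (auto simp: f[OF ab] h_def v)
  qed
  have "d x x = 0"
    using d xy unfolding ultra_pseudometric_on_def by blast
  \<comment> \<open>For \<open>r > 0\<close> the ball contains its centre \<open>x\<close> but not
    \<open>y\<close>; for \<open>r = 0\<close> both sides vanish.\<close>
  then show "r * val (f (x - y)) = d x y"
    using r by (auto simp: f[OF xy] h_def v r_def)
qed

lemma is_kantorovich_exists: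
  fixes d :: "('x \<Rightarrow>\<^sub>0 'f::field) \<Rightarrow> ('x \<Rightarrow>\<^sub>0 'f) \<Rightarrow> real"
  assumes val: "NA_valuation val" and d: "ultra_pseudometric_on pointed_set d"
  shows "\<exists>p. is_kantorovich val d p"
proof -
  \<comment> \<open>Only \<open>\<le>\<close> is demanded, so that the ultra-seminorms attaining
    \<open>d\<close> at a single pair belong to \<open>Q\<close>; equality at all pairs is recovered
    by the supremum.\<close>
  define Q where "Q = {q. ultra_seminorm val free_scale q \<and>
    (\<forall>x\<in>pointed_set. \<forall>y\<in>pointed_set. q (x - y) \<le> d x y)}"
  let ?p = "\<lambda>u. SUP q\<in>Q. q u"
  have bdd: "bdd_above ((\<lambda>q. q u) ` Q)" for u
  proof (rule bdd_aboveI2)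
    fix q assume q: "q \<in> Q"
    \<comment> \<open>Having 0 among the points bounds \<open>q\<close> on the basis, since a basis
      vector is its own difference from 0.\<close>
    have le: "q (free_inclusion x) \<le> d (free_inclusion x) 0" for x
      using q unfolding Q_def
      by (metis (lifting) diff_zero free_inclusion_in_pointed_set mem_Collect_eq zero_in_pointed_set)
    have "q u \<le> (\<Sum>x\<in>Poly_Mapping.keys u. val (Poly_Mapping.lookup u x) * q (free_inclusion x))"
      using q unfolding Q_def by (intro ultra_seminorm_le_sum_keys) auto
    also have "\<dots> \<le> (\<Sum>x\<in>Poly_Mapping.keys u.
        val (Poly_Mapping.lookup u x) * d (free_inclusion x) 0)"
      using le val unfolding NA_valuation_def by (intro sum_mono mult_left_mono) auto
    finally show "q u \<le> (\<Sum>x\<in>Poly_Mapping.keys u.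
        val (Poly_Mapping.lookup u x) * d (free_inclusion x) 0)" .
  qed
  have upper: "q u \<le> ?p u" if "q \<in> Q" for q u
    using that bdd by (rule cSUP_upper)
  have attained: "\<exists>q\<in>Q. q (x - y) = d x y" if xy: "x \<in> pointed_set" "y \<in> pointed_set" for x y
  proof (rule ultra_seminorm_attaining_distance[OF val d xy])
    fix q assume "ultra_seminorm val free_scale q" "q (x - y) = d x y"
      and "\<And>a b. \<lbrakk>a \<in> pointed_set; b \<in> pointed_set\<rbrakk> \<Longrightarrow> q (a - b) \<le> d a b"
    then have "q \<in> Q"
      unfolding Q_def by simp
    with \<open>q (x - y) = d x y\<close> show ?thesis
      by blast
  qed
  have ne: "Q \<noteq> {}"
    using attained[of 0 0] by auto
  have "ultra_seminorm val free_scale ?p"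
    using bdd by (intro ultra_seminorm_SUP[OF val vector_space_free_scale ne]) (auto simp: Q_def)
  moreover have "?p (x - y) = d x y" if xy: "x \<in> pointed_set" "y \<in> pointed_set" for x y
  proof (rule antisym)
    show "?p (x - y) \<le> d x y"
      using xy by (intro cSUP_least[OF ne]) (auto simp: Q_def)
    obtain q where "q \<in> Q" "q (x - y) = d x y"
      using attained[OF xy] by blast
    then show "d x y \<le> ?p (x - y)"
      using upper[of q "x - y"] by simp
  qed
  moreover have "q u \<le> ?p u"
    if "ultra_seminorm val free_scale q" "\<forall>x\<in>pointed_set. \<forall>y\<in>pointed_set. q (x - y) = d x y" for q u
    using that by (intro upper) (auto simp: Q_def)
  ultimately have "is_kantorovich val d ?p"
    unfolding is_kantorovich_def by blast
  then show ?thesis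
    by (intro exI[of _ ?p])
qed

text \<open>Two maximal ultra-seminorms dominate each other, so the definite description is
  legitimate.\<close>

lemma is_kantorovich_kantorovich:
  assumes "NA_valuation val" "ultra_pseudometric_on pointed_set d"
  shows "is_kantorovich val d (kantorovich val d)"
proof -
  have "p = q" if "is_kantorovich val d p" "is_kantorovich val d q" for p q
    using that unfolding is_kantorovich_def by (intro ext order_antisym) blast+
  then have "\<exists>!p. is_kantorovich val d p"
    using is_kantorovich_exists[OF assms] by blast
  then show ?thesis
    unfolding kantorovich_def by (rule theI')
qed

section \<open>Uniformly continuous ultra-pseudometrics\<close>

lemma is_uniformity_refl:
  assumes "is_uniformity U" "eventually E U"
  shows "E (x, x)"
proof -
  have "class.uniform_space_axioms U"
    using assms(1) unfolding is_uniformity_def class.uniform_space_def by (rule conjunct2)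
  then have "\<forall>E x. eventually E U \<longrightarrow> E (x, x)"
    unfolding class.uniform_space_axioms_def by (rule conjunct1)
  then show ?thesis
    using assms(2) by (elim allE[of _ E] allE[of _ x]) (rule mp)
qed

text \<open>Two triangle inequalities bound the variation of \<open>d\<close> by
  \<open>d x1 x2 + d y1 y2\<close>, so uniform continuity on the product reduces to smallness of
  \<open>d\<close> near the diagonal. The isolated point contributes only the pair
  \<open>(0, 0)\<close>, where \<open>d\<close> vanishes.\<close>

lemma uc_ultra_pseudometrics_iff:
  fixes d :: "('x \<Rightarrow>\<^sub>0 'f::field) \<Rightarrow> ('x \<Rightarrow>\<^sub>0 'f) \<Rightarrow> real"
  assumes U: "is_uniformity U"
  shows "d \<in> uc_ultra_pseudometrics U \<longleftrightarrow>
    ultra_pseudometric_on pointed_set d \<and>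
    (\<forall>e>0. \<forall>\<^sub>F (x, y) in U. d (free_inclusion x) (free_inclusion y) < e)"
proof -
  let ?W = "pointed_uniformity U :: (('x \<Rightarrow>\<^sub>0 'f) \<times> ('x \<Rightarrow>\<^sub>0 'f)) filter"
  have ev_W: "eventually E ?W \<longleftrightarrow>
      (\<forall>\<^sub>F (x, y) in U. E (free_inclusion x, free_inclusion y)) \<and> E (0, 0)" for E
    unfolding pointed_uniformity_def
    by (simp add: eventually_sup eventually_filtermap eventually_principal map_prod_def case_prod_unfold)
  have refl: "E (a, a)" if "eventually E ?W" "a \<in> pointed_set" for E a
    using that is_uniformity_refl[OF U, of "\<lambda>(x, y). E (free_inclusion x, free_inclusion y)"]
    unfolding ev_W pointed_set_def by auto
  have uc: "uniformly_continuous_map (prod_uniformity ?W ?W) uniformity (\<lambda>(x, y). d x y) \<longleftrightarrow>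
      (\<forall>e>0. \<exists>E E'. eventually E ?W \<and> eventually E' ?W \<and>
        (\<forall>x1 x2 y1 y2. E (x1, x2) \<longrightarrow> E' (y1, y2) \<longrightarrow> dist (d x1 y1) (d x2 y2) < e))"
  proof -
    have "uniformly_continuous_map (prod_uniformity ?W ?W) uniformity (\<lambda>(x, y). d x y) \<longleftrightarrow>
        (\<forall>e>0. \<forall>\<^sub>F ((x1, x2), (y1, y2)) in ?W \<times>\<^sub>F ?W. dist (d x1 y1) (d x2 y2) < e)"
      unfolding uniformly_continuous_map_def prod_uniformity_def uniformity_dist filterlim_INF
        filterlim_principal
      by (simp add: eventually_filtermap case_prod_unfold Ball_def)
    then show ?thesis
      unfolding eventually_prod_filter by simp
  qed
  show ?thesis
  proof (cases "ultra_pseudometric_on pointed_set d")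
    case True
    have zero: "d a a = 0" if "a \<in> pointed_set" for a
      using True that unfolding ultra_pseudometric_on_def by blast
    have sym: "d a b = d b a" if "a \<in> pointed_set" "b \<in> pointed_set" for a b
      using True that unfolding ultra_pseudometric_on_def by blast
    have nonneg: "0 \<le> d a b" if "a \<in> pointed_set" "b \<in> pointed_set" for a b
      using True that unfolding ultra_pseudometric_on_def by blast
    have tri: "d a c \<le> d a b + d b c"
      if "a \<in> pointed_set" "b \<in> pointed_set" "c \<in> pointed_set" for a b c
    proof -
      have "d a c \<le> max (d a b) (d b c)"
        using True that unfolding ultra_pseudometric_on_def by blast
      with nonneg[of a b] nonneg[of b c] that show ?thesis by linarith
    qed
    have "uniformly_continuous_map (prod_uniformity ?W ?W) uniformity (\<lambda>(x, y). d x y) \<longleftrightarrow>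
      (\<forall>e>0. \<forall>\<^sub>F (x, y) in U. d (free_inclusion x) (free_inclusion y) < e)"
      unfolding uc
    proof (intro iffI allI impI)
      fix e :: real
      assume L: "\<forall>e>0. \<exists>E E'. eventually E ?W \<and> eventually E' ?W \<and>
        (\<forall>x1 x2 y1 y2. E (x1, x2) \<longrightarrow> E' (y1, y2) \<longrightarrow> dist (d x1 y1) (d x2 y2) < e)" and "0 < e"
      then obtain E E' where E: "eventually E ?W" "eventually E' ?W"
        "\<And>x1 x2 y1 y2. \<lbrakk>E (x1, x2); E' (y1, y2)\<rbrakk> \<Longrightarrow> dist (d x1 y1) (d x2 y2) < e"
        by meson
      have "d (free_inclusion x) (free_inclusion y) < e"
        if "E (free_inclusion x, free_inclusion y)" for x y
        \<comment> \<open>With the second pair on the diagonal, \<open>d x y\<close> is compared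
          with \<open>d y y = 0\<close>.\<close>
        using E(3)[OF that refl[OF E(2), of "free_inclusion y"]] zero[of "free_inclusion y"]
        by (simp add: dist_real_def)
      then show "\<forall>\<^sub>F (x, y) in U. d (free_inclusion x) (free_inclusion y) < e"
        using E(1) unfolding ev_W by (auto elim: eventually_mono)
    next
      fix e :: real
      assume R: "\<forall>e>0. \<forall>\<^sub>F (x, y) in U. d (free_inclusion x) (free_inclusion y) < e" and e: "0 < e"
      \<comment> \<open>Membership is recorded in the entourage because \<open>d\<close> obeys the
        pseudometric laws only on \<open>pointed_set\<close>.\<close>
      let ?E = "\<lambda>(a, b). a \<in> pointed_set \<and> b \<in> pointed_set \<and> d a b < e / 2"
      have "\<forall>\<^sub>F (x, y) in U. d (free_inclusion x) (free_inclusion y) < e / 2"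
        using R e half_gt_zero by blast
      then have "eventually ?E ?W"
        using e zero[of 0] unfolding ev_W by simp
      moreover have "dist (d x1 y1) (d x2 y2) < e" if "?E (x1, x2)" "?E (y1, y2)" for x1 x2 y1 y2
        using that tri[of x1 x2 y1] tri[of x2 y2 y1] tri[of x2 x1 y2] tri[of x1 y1 y2]
          sym[of x1 x2] sym[of y1 y2]
        by (auto simp: dist_real_def)
      ultimately show "\<exists>E E'. eventually E ?W \<and> eventually E' ?W \<and>
        (\<forall>x1 x2 y1 y2. E (x1, x2) \<longrightarrow> E' (y1, y2) \<longrightarrow> dist (d x1 y1) (d x2 y2) < e)"
        by blast
    qed
    with True show ?thesis
      unfolding uc_ultra_pseudometrics_def by simp
  qed (simp add: uc_ultra_pseudometrics_def)
qed

text \<open>For the \<open>d\<close> induced by \<open>q\<close>, the function \<open>q\<close> is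
  itself a competitor in \<open>is_kantorovich\<close>, so the maximality clause applies to
  it.\<close>

lemma kantorovich_dominates_uc_seminorm:
  assumes val: "NA_valuation val" and U: "is_uniformity U"
    and q: "ultra_seminorm val free_scale q"
    and ev: "\<And>e. 0 < e \<Longrightarrow> \<forall>\<^sub>F (x, y) in U. q (free_inclusion y - free_inclusion x) < e"
  obtains d where "d \<in> uc_ultra_pseudometrics U" "\<And>u. q u \<le> kantorovich val d u"
proof
  define d where "d = (\<lambda>x y. q (x - y))"
  note comm = ultra_seminorm_commute[OF val vector_space_free_scale q]
  have d: "ultra_pseudometric_on pointed_set d"
    unfolding ultra_pseudometric_on_def d_def
  proof (intro conjI ballI)
    fix x y z
    show "0 \<le> q (x - y)" "q (x - x) = 0"
      using q unfolding ultra_seminorm_def by auto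
    show "q (x - y) = q (y - x)"
      by (rule comm)
    show "q (x - z) \<le> max (q (x - y)) (q (y - z))"
      by (rule ultra_seminorm_triangle[OF q])
  qed
  then show "d \<in> uc_ultra_pseudometrics U"
    using ev unfolding uc_ultra_pseudometrics_iff[OF U] d_def by (simp add: comm)
  show "q u \<le> kantorovich val d u" for u
    using is_kantorovich_kantorovich[OF val d] q unfolding is_kantorovich_def d_def by blast
qed

section \<open>Entourages that are equivalence relations\<close>

lemma NA_uniformity_equiv:
  assumes "NA_uniformity U" "eventually E U"
  obtains R where "equiv UNIV R" "\<forall>\<^sub>F z in U. z \<in> R" "\<And>z. z \<in> R \<Longrightarrow> E z"
proof -
  have "\<exists>R. equiv UNIV R \<and> (\<forall>\<^sub>F z in U. z \<in> R) \<and> (\<forall>z\<in>R. E z)"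
    using assms unfolding NA_uniformity_def by simp
  then show ?thesis
    using that by auto
qed

text \<open>An open set around \<open>x\<close> that misses \<open>y\<close> gives an entourage
  without \<open>(x, y)\<close>. Finitely many of these are intersected and refined to an
  equivalence relation.\<close>

lemma entourage_separating_finite:
  assumes U: "NA_uniformity U" "Hausdorff_uniformity U" and A: "finite A" "x \<notin> A"
  obtains R where "equiv UNIV R" "\<forall>\<^sub>F z in U. z \<in> R" "\<And>y. y \<in> A \<Longrightarrow> (x, y) \<notin> R"
proof -
  have "\<forall>\<^sub>F z in U. z \<noteq> (x, y)" if "y \<in> A" for y
  proof -
    from that A have "x \<noteq> y" by blast
    then obtain S T where S: "uniform_open U S" "x \<in> S" and "y \<in> T" "S \<inter> T = {}"
      using U(2) unfolding Hausdorff_uniformity_def class.t2_space_def class.t2_space_axioms_def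
      by metis
    then show ?thesis
      unfolding uniform_open_def by (force elim!: eventually_mono dest!: bspec)
  qed
  then have "\<forall>\<^sub>F z in U. \<forall>y\<in>A. z \<noteq> (x, y)"
    using A by (simp add: eventually_ball_finite)
  with U(1) obtain R where "equiv UNIV R" "\<forall>\<^sub>F z in U. z \<in> R"
      "\<And>z. z \<in> R \<Longrightarrow> \<forall>y\<in>A. z \<noteq> (x, y)"
    by (rule NA_uniformity_equiv) (rule that)
  then show ?thesis
    by (intro that) auto
qed

section \<open>The free non-archimedean locally convex space\<close>

lemma ultra_seminorm_kantorovich:
  assumes "NA_valuation val" "d \<in> uc_ultra_pseudometrics U"
  shows "ultra_seminorm val free_scale (kantorovich val d)"
  using is_kantorovich_kantorovich[OF assms(1), of d] assms(2)
  unfolding is_kantorovich_def uc_ultra_pseudometrics_def by blast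

lemma kantorovich_diff:
  assumes "NA_valuation val" "d \<in> uc_ultra_pseudometrics U" "x \<in> pointed_set" "y \<in> pointed_set"
  shows "kantorovich val d (x - y) = d x y"
  using is_kantorovich_kantorovich[OF assms(1), of d] assms(2-4)
  unfolding is_kantorovich_def uc_ultra_pseudometrics_def by blast

text \<open>It suffices to find a linear functional that is nonzero at \<open>u\<close> and constant
  on the classes of an entourage: its valuation lies below some Kantorovich ultra-seminorm, which
  then detects \<open>u\<close>.\<close>

lemma Hausdorff_free_topology:
  fixes val :: "'f::field \<Rightarrow> real" and U :: "('x \<times> 'x) filter"
  assumes val: "NA_valuation val" and U: "NA_uniformity U" "Hausdorff_uniformity U"
  shows "Hausdorff_space (free_topology val U)"
  unfolding free_topology_def
proof (rule Hausdorff_seminorm_topology[OF val vector_space_free_scale])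
  fix u :: "'x \<Rightarrow>\<^sub>0 'f" assume "u \<noteq> 0"
  then obtain x where x: "Poly_Mapping.lookup u x \<noteq> 0"
    by (metis poly_mapping_eqI lookup_zero)
  obtain R where R: "equiv UNIV R" "\<forall>\<^sub>F z in U. z \<in> R"
      "\<And>y. y \<in> Poly_Mapping.keys u - {x} \<Longrightarrow> (x, y) \<notin> R"
    using entourage_separating_finite[OF U, of "Poly_Mapping.keys u - {x}" x] by auto
  \<comment> \<open>Since \<open>x\<close> is the only support point of \<open>u\<close> in its
    class, the sum of coefficients over that class is the coefficient at \<open>x\<close>.\<close>
  define f where "f = linear_extension (*) (\<lambda>y. if (x, y) \<in> R then 1 else (0 :: 'f))"
  have vs: "vector_space ((*) :: 'f \<Rightarrow> 'f \<Rightarrow> 'f)"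
    by unfold_locales (auto simp: algebra_simps)
  then have lin: "Vector_Spaces.linear free_scale (*) f"
    unfolding f_def by (rule linear_linear_extension)
  interpret Vector_Spaces.linear free_scale "(*)" f by fact
  have xx: "(x, x) \<in> R"
    using R(1) by (meson UNIV_I equiv_class_self equivE refl_onD)
  have "f u = (\<Sum>y\<in>Poly_Mapping.keys u. if y = x then Poly_Mapping.lookup u y else 0)"
    unfolding f_def linear_extension_def using R(3) xx by (intro sum.cong) auto
  also have "\<dots> = Poly_Mapping.lookup u x"
    using x by (simp add: in_keys_iff)
  finally have fu: "val (f u) \<noteq> 0"
    using x val unfolding NA_valuation_def by simp
  have "ultra_seminorm val free_scale (\<lambda>u. val (f u))"
    using ultra_seminorm_compose_linear[OF ultra_seminorm_valuation[OF val, of 1] lin] by simp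
  \<comment> \<open>Related points lie both inside or both outside the class of \<open>x\<close>, so
    the value is 0 on all of \<open>R\<close>, and one entourage serves every
    \<open>e\<close>.\<close>
  moreover have "\<forall>\<^sub>F (y, z) in U. val (f (free_inclusion z - free_inclusion y)) < e" if "0 < e" for e
    using R(2)
  proof (rule eventually_mono, safe)
    fix y z assume "(y, z) \<in> R"
    then have "(x, y) \<in> R \<longleftrightarrow> (x, z) \<in> R"
      using R(1) by (meson equivE symE transE)
    then have "f (free_inclusion z) = f (free_inclusion y)"
      using vs by (simp add: f_def)
    then show "val (f (free_inclusion z - free_inclusion y)) < e"
      using that by (simp add: diff NA_valuation_zero[OF val])
  qed
  moreover have "is_uniformity U"
    using U(1) unfolding NA_uniformity_def by blast
  ultimately obtain d where "d \<in> uc_ultra_pseudometrics U" "val (f u) \<le> kantorovich val d u"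
    using kantorovich_dominates_uc_seminorm[OF val, of U "\<lambda>u. val (f u)"] by blast
  then show "\<exists>p\<in>kantorovich val ` uc_ultra_pseudometrics U. p u \<noteq> 0"
    using fu val unfolding NA_valuation_def by (metis imageI order_antisym)
qed (auto intro: ultra_seminorm_kantorovich[OF val])

lemma NA_locally_convex_space_free_topology:
  assumes "NA_valuation val" "NA_uniformity U" "Hausdorff_uniformity U"
  shows "NA_locally_convex_space val free_scale (free_topology val U)"
  unfolding NA_locally_convex_space_def
proof (intro conjI exI)
  show "topological_vector_space val free_scale (free_topology val U)"
    unfolding free_topology_def using ultra_seminorm_kantorovich[OF assms(1)]
    by (intro topological_vector_space_seminorm_topology assms vector_space_free_scale) auto
  show "free_topology val U = seminorm_topology (kantorovich val ` uc_ultra_pseudometrics U)"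
    by (rule free_topology_def)
qed (use assms in \<open>auto intro: Hausdorff_free_topology ultra_seminorm_kantorovich\<close>)

text \<open>On differences of basis vectors each generating ultra-seminorm equals its
  \<open>d\<close>, which is small on entourages.\<close>

lemma uniformly_continuous_free_inclusion:
  fixes val :: "'f::field \<Rightarrow> real" and U :: "('x \<times> 'x) filter"
  assumes val: "NA_valuation val" and U: "is_uniformity U"
  shows "uniformly_continuous_map U (additive_uniformity (free_topology val U)) free_inclusion"
proof -
  have K: "\<And>p. p \<in> kantorovich val ` uc_ultra_pseudometrics U \<Longrightarrow> ultra_seminorm val free_scale p"
    using ultra_seminorm_kantorovich[OF val] by auto
  have "\<forall>\<^sub>F (x, y) in U. kantorovich val d (free_inclusion y - free_inclusion x) < e"
    if d: "d \<in> uc_ultra_pseudometrics U" and "0 < e" for d :: "('x \<Rightarrow>\<^sub>0 'f) \<Rightarrow> ('x \<Rightarrow>\<^sub>0 'f) \<Rightarrow> real" and e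
  proof -
    have "\<forall>\<^sub>F (x, y) in U. d (free_inclusion x) (free_inclusion y) < e"
      using that unfolding uc_ultra_pseudometrics_iff[OF U] by blast
    then show ?thesis
      using ultra_seminorm_commute[OF val vector_space_free_scale ultra_seminorm_kantorovich[OF val d]]
      by (simp add: kantorovich_diff[OF val d])
  qed
  then show ?thesis
    unfolding free_topology_def
    by (subst uniformly_continuous_map_into_seminorm_topology) (auto intro: K)
qed

lemma continuous_linear_extension:
  fixes \<phi> :: "'x \<Rightarrow> 'v::ab_group_add"
  assumes val: "NA_valuation val" and U: "is_uniformity U"
    and V: "NA_locally_convex_space val s V"
    and \<phi>: "uniformly_continuous_map U (additive_uniformity V) \<phi>"
  shows "continuous_map (free_topology val U) V (linear_extension s \<phi>)"
proof -
  let ?\<Phi> = "linear_extension s \<phi>"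
  obtain P where P: "\<And>p. p \<in> P \<Longrightarrow> ultra_seminorm val s p" and V_eq: "V = seminorm_topology P"
    using V unfolding NA_locally_convex_space_def by blast
  have s: "vector_space s"
    using V unfolding NA_locally_convex_space_def topological_vector_space_def by blast
  then have lin: "Vector_Spaces.linear free_scale s ?\<Phi>"
    by (rule linear_linear_extension)
  interpret Vector_Spaces.linear free_scale s ?\<Phi> by fact
  have \<phi>_small: "\<forall>\<^sub>F (x, y) in U. p (\<phi> y - \<phi> x) < e" if "p \<in> P" "0 < e" for p e
    using \<phi> that P unfolding V_eq
    by (subst (asm) uniformly_continuous_map_into_seminorm_topology) auto
  show ?thesis
    unfolding V_eq
  proof (rule continuous_map_into_seminorm_topology)
    fix p v and e :: real assume p: "p \<in> P" and e: "0 < e"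
    have "\<forall>\<^sub>F (x, y) in U. p (?\<Phi> (free_inclusion y - free_inclusion x)) < e'" if "0 < e'" for e'
      using \<phi>_small[OF p that] s by (simp add: diff)
    then obtain d where d: "d \<in> uc_ultra_pseudometrics U"
        "\<And>u. p (?\<Phi> u) \<le> kantorovich val d u"
      using kantorovich_dominates_uc_seminorm[OF val U ultra_seminorm_compose_linear[OF P[OF p] lin]]
      by blast
    show "openin (free_topology val U) {u \<in> topspace (free_topology val U). p (?\<Phi> u - v) < e}"
    proof (subst openin_subopen, safe)
      fix u assume u: "p (?\<Phi> u - v) < e"
      let ?B = "{w. kantorovich val d (w - u) < e}"
      \<comment> \<open>The ultrametric inequality through \<open>?\<Phi> u\<close> allows the same
        radius \<open>e\<close>, wherever the centre \<open>v\<close> lies.\<close>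
      have "p (?\<Phi> w - v) < e" if "kantorovich val d (w - u) < e" for w
        using ultra_seminorm_triangle[OF P[OF p], of "?\<Phi> w" v "?\<Phi> u"] u that d(2)[of "w - u"]
        by (simp add: diff)
      moreover have "openin (free_topology val U) ?B"
        unfolding free_topology_def using d e by (intro openin_seminorm_ball) auto
      moreover have "u \<in> ?B"
        using ultra_seminorm_kantorovich[OF val d(1)] e by (simp add: ultra_seminorm_def)
      ultimately show "\<exists>T. openin (free_topology val U) T \<and> u \<in> T \<and>
          T \<subseteq> {u \<in> topspace (free_topology val U). p (?\<Phi> u - v) < e}"
        by (intro exI[of _ ?B]) (auto simp: free_topology_def)
    qed
  qed
qed

text \<open>An entourage \<open>R\<close> that is an equivalence relation defines a 0-1-valued
  ultra-pseudometric; the unit ball of its Kantorovich ultra-seminorm recovers \<open>R\<close> on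
  the basis.\<close>

lemma uniform_embedding_free_inclusion:
  fixes val :: "'f::field \<Rightarrow> real" and U :: "('x \<times> 'x) filter"
  assumes val: "NA_valuation val" and NA: "NA_uniformity U"
  shows "uniform_embedding U (additive_uniformity (free_topology val U))
    (free_inclusion :: 'x \<Rightarrow> ('x \<Rightarrow>\<^sub>0 'f))"
proof -
  let ?i = "free_inclusion :: 'x \<Rightarrow> ('x \<Rightarrow>\<^sub>0 'f)"
  let ?A = "additive_uniformity (free_topology val U)"
  have U: "is_uniformity U"
    using NA unfolding NA_uniformity_def by blast
  have "\<forall>\<^sub>F z in inf ?A (principal (range ?i \<times> range ?i)).
      E (case z of (a, b) \<Rightarrow> (inv ?i a, inv ?i b))" if E: "eventually E U" for E
  proof -
    obtain R where R: "equiv UNIV R" "\<forall>\<^sub>F z in U. z \<in> R" "\<And>z. z \<in> R \<Longrightarrow> E z"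
      using NA E by (rule NA_uniformity_equiv) (rule that)
    have R_refl: "(x, x) \<in> R" and R_sym: "(x, y) \<in> R \<Longrightarrow> (y, x) \<in> R"
      and R_trans: "(x, y) \<in> R \<Longrightarrow> (y, z) \<in> R \<Longrightarrow> (x, z) \<in> R" for x y z
      using R(1) by (auto elim!: equivE dest: symD transD simp: refl_on_def)
    \<comment> \<open>Adding equality extends \<open>R\<close> to an equivalence relation on all
      vectors, in which 0 is related only to itself.\<close>
    define T where "T a b \<longleftrightarrow> a = b \<or> (\<exists>x y. a = ?i x \<and> b = ?i y \<and> (x, y) \<in> R)" for a b
    define d :: "('x \<Rightarrow>\<^sub>0 'f) \<Rightarrow> ('x \<Rightarrow>\<^sub>0 'f) \<Rightarrow> real" where
      "d a b = (if T a b then 0 else 1)" for a b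
    have d_i: "d (?i x) (?i y) = (if (x, y) \<in> R then 0 else 1)" for x y
      using R_refl by (auto simp: d_def T_def)
    have T_sym: "T b a" if "T a b" for a b
      using that R_sym unfolding T_def by blast
    have T_trans: "T a c" if "T a b" "T b c" for a b c
    proof (cases "a = b \<or> b = c")
      case False
      with that(1) obtain x y where xy: "a = ?i x" "b = ?i y" "(x, y) \<in> R"
        unfolding T_def by blast
      moreover from False that(2) obtain y' z where "b = ?i y'" "c = ?i z" "(y', z) \<in> R"
        unfolding T_def by blast
      \<comment> \<open>Injectivity of the inclusion identifies the two preimages \<open>y\<close>
        and \<open>y'\<close> of \<open>b\<close>.\<close>
      ultimately have "(x, z) \<in> R" and "a = ?i x" "c = ?i z"
        using R_trans by auto
      then show ?thesis
        unfolding T_def by blast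
    qed (use that in auto)
    have "ultra_pseudometric_on pointed_set d"
      unfolding ultra_pseudometric_on_def
    proof (intro conjI ballI)
      fix a b c
      show "0 \<le> d a b" "d a a = 0"
        by (simp_all add: d_def T_def)
      show "d a b = d b a"
        using T_sym[of a b] T_sym[of b a] by (auto simp: d_def)
      show "d a c \<le> max (d a b) (d b c)"
        using T_trans[of a b c] by (auto simp: d_def)
    qed
    then have d: "d \<in> uc_ultra_pseudometrics U"
      unfolding uc_ultra_pseudometrics_iff[OF U] d_i
      using R(2) by (auto elim: eventually_mono)
    have "openin (free_topology val U) {u. kantorovich val d (u - 0) < 1}"
      unfolding free_topology_def using d by (intro openin_seminorm_ball) auto
    then have "\<forall>\<^sub>F u in nhdsin (free_topology val U) 0. kantorovich val d u < 1"
      unfolding eventually_nhdsin using ultra_seminorm_kantorovich[OF val d]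
      by (intro disjI2 exI[of _ "{u. kantorovich val d (u - 0) < 1}"])
         (auto simp: ultra_seminorm_def)
    then have "\<forall>\<^sub>F (a, b) in ?A. kantorovich val d (b - a) < 1"
      unfolding additive_uniformity_def eventually_filtercomap by auto
    then show ?thesis
      unfolding eventually_inf_principal
    proof (rule eventually_mono, safe)
      fix x y assume "kantorovich val d (?i y - ?i x) < 1"
      \<comment> \<open>The ultra-seminorm equals \<open>d\<close> here and takes only the values 0
        and 1, so being below 1 means being related.\<close>
      then have "(y, x) \<in> R"
        by (simp add: kantorovich_diff[OF val d] d_i split: if_splits)
      then show "E (inv ?i (?i x), inv ?i (?i y))"
        using R(3) R_sym by (simp add: inv_f_f[OF inj_free_inclusion])
    qed
  qed
  then have "uniformly_continuous_map (inf ?A (principal (range ?i \<times> range ?i))) U (inv ?i)"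
    unfolding uniformly_continuous_map_def filterlim_iff by (auto simp: case_prod_unfold)
  then show ?thesis
    using inj_free_inclusion uniformly_continuous_free_inclusion[OF val U]
    unfolding uniform_embedding_def by blast
qed

theorem theorem6p2:
  fixes val :: "'f::field \<Rightarrow> real" and U :: "('x \<times> 'x) filter"
  assumes "NA_valuation val"
    and "NA_uniformity U"
    and "Hausdorff_uniformity U"
  shows "free_NA_locally_convex_space TYPE('v::ab_group_add) val U
           free_scale (free_topology val U) free_inclusion \<and>
         uniform_embedding U (additive_uniformity (free_topology val U))
           (free_inclusion :: 'x \<Rightarrow> ('x \<Rightarrow>\<^sub>0 'f))"
proof
  have U: "is_uniformity U"
    using assms(2) unfolding NA_uniformity_def by blast
  have "\<exists>!\<Phi>. Vector_Spaces.linear free_scale s \<Phi> \<and> continuous_map (free_topology val U) V \<Phi> \<and>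
      \<Phi> \<circ> free_inclusion = \<phi>"
    if V: "NA_locally_convex_space val s V"
      and \<phi>: "uniformly_continuous_map U (additive_uniformity V) \<phi>"
    for s :: "'f \<Rightarrow> 'v \<Rightarrow> 'v" and V and \<phi> :: "'x \<Rightarrow> 'v"
  proof (rule ex1I[of _ "linear_extension s \<phi>"])
    have s: "vector_space s"
      using V unfolding NA_locally_convex_space_def topological_vector_space_def by blast
    show "Vector_Spaces.linear free_scale s (linear_extension s \<phi>) \<and>
        continuous_map (free_topology val U) V (linear_extension s \<phi>) \<and>
        linear_extension s \<phi> \<circ> free_inclusion = \<phi>"
      using linear_linear_extension[OF s] continuous_linear_extension[OF assms(1) U V \<phi>] s
      by (auto simp: fun_eq_iff)
  \<comment> \<open>Uniqueness: a linear map is determined by its values on the basis.\<close>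
  qed (use linear_eq_linear_extension in blast)
  then show "free_NA_locally_convex_space TYPE('v) val U free_scale (free_topology val U)
      (free_inclusion :: 'x \<Rightarrow> ('x \<Rightarrow>\<^sub>0 'f))"
    using NA_locally_convex_space_free_topology[OF assms]
      uniformly_continuous_free_inclusion[OF assms(1) U]
    unfolding free_NA_locally_convex_space_def by blast
  show "uniform_embedding U (additive_uniformity (free_topology val U))
      (free_inclusion :: 'x \<Rightarrow> ('x \<Rightarrow>\<^sub>0 'f))"
    by (rule uniform_embedding_free_inclusion[OF assms(1,2)])
qed

end
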